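(* The function $$G(x)=\left[\frac{\pi^{x}}{\Gamma(x+1)}\right]^{1/[\ln(x^2+1)-\ln(x+1)]}$$ is strictly decreasing on $(1,\infty)$. Consequently, the sequence $$\Omega_n^{1/[\ln(n^2/4+1)-\ln(n/2+1)]}$$ is strictly decreasing for integers $n\ge 3$.
   Context: $\Gamma(x)=\int_0^\infty t^{x-1}e^{-t}\,dt$ for $x>0$ is Euler's gamma function and $\ln$ is the natural logarithm. For $n\in\mathbb{N}$, $\Omega_n=\dfrac{\pi^{n/2}}{\Gamma(1+n/2)}$ denotes the $n$-dimensional volume of the unit ball $\mathbb{B}^n$ in $\mathbb{R}^n$. *)

theory Defs
  imports "HOL-Analysis.Analysis"
begin

end

theory Submission
  imports Defs
begin

text \<open>
  Write the logarithm of the function as \<open>f / g\<close> with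
  \<open>f x = x ln \<pi> - ln \<Gamma>(x + 1)\<close> and \<open>g x = ln (x\<^sup>2 + 1) - ln (x + 1)\<close>, where \<open>g 1 = 0 < f 1\<close>.
  If \<open>f' / g'\<close> is decreasing on \<open>[1, \<infinity>)\<close>, then \<open>h = (f' / g') g - f\<close> has derivative
  \<open>(f' / g')' g \<le> 0\<close> and \<open>h 1 < 0\<close>, so that \<open>(f / g)' = g' h / g\<^sup>2 < 0\<close>.
  For the monotonicity of \<open>f' / g'\<close> put \<open>k = 1 / g'\<close>; then \<open>(f' k)' < 0\<close> amounts to
  \<open>f' k' / k < \<psi>'(x + 1)\<close>. Here \<open>\<psi>'(y) \<ge> 1 / y\<close>, \<open>k' / k < 8 / 25\<close> and \<open>f' < 39 / 50\<close> settle
  \<open>x \<le> 3\<close>, while \<open>f' < 0 < k'\<close> for \<open>x \<ge> 3\<close>.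
\<close>

section \<open>Bounds for the trigamma function and \<open>ln pi\<close>\<close>

lemma Polygamma_1_ge_inverse:
  fixes y :: real
  assumes y: "y > 0"
  shows "Polygamma 1 y \<ge> 1 / y"
proof -
  have "(\<lambda>k. inverse ((y + of_nat k) ^ Suc 1)) sums ((-1) ^ Suc 1 * Polygamma 1 y / fact 1)"
    using y by (intro Polygamma_LIMSEQ) auto
  hence S: "(\<lambda>k. inverse ((y + real k) ^ 2)) sums Polygamma 1 y"
    by (simp add: numeral_2_eq_2)
  have "(\<lambda>k. inverse (y + real k)) \<longlonglongrightarrow> 0"
    by (intro tendsto_inverse_0_at_top filterlim_tendsto_add_at_top[OF tendsto_const]
          filterlim_real_sequentially)
  \<comment> \<open>With z = y + k, the telescoping term is 1 / (z (z + 1)), which lies below the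
    trigamma term 1 / z^2.\<close>
  hence T: "(\<lambda>k. inverse (y + real k) - inverse (y + real (Suc k))) sums inverse y"
    using telescope_sums'[of "\<lambda>k. inverse (y + real k)" 0] by simp
  have "inverse (y + real k) - inverse (y + real (Suc k)) \<le> inverse ((y + real k) ^ 2)" for k
  proof -
    define z where "z = y + real k"
    have z: "z > 0" using y by (simp add: z_def)
    have "inverse z - inverse (z + 1) = 1 / (z * (z + 1))"
      using z by (simp add: field_simps)
    also have "\<dots> \<le> 1 / z\<^sup>2"
      using z by (intro divide_left_mono) (auto simp: power2_eq_square)
    finally show ?thesis by (simp add: z_def field_simps)
  qed
  from sums_le[OF this T S] show ?thesis by (simp add: inverse_eq_divide)
qed

text \<open>The lower bound is sharp enough for \<open>f' 2 > 0\<close>, the upper one for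
  \<open>f' 1 < 39 / 50\<close> and \<open>f' 3 < 0\<close>.\<close>

lemma ln_pi_bounds: "1 < ln pi" "ln pi < 59 / 50"
proof -
  have "exp 1 < pi" using e_less_272 pi_gt3 by linarith
  hence "ln (exp 1) < ln pi" by (subst ln_less_cancel_iff) auto
  thus "1 < ln pi" by simp
next
  \<comment> \<open>Five terms of the exponential series already exceed 3.2, hence pi.\<close>
  have "(\<Sum>n<5. inverse (fact n) *\<^sub>R (59 / 50) ^ n) \<le> exp (59 / 50 :: real)"
    unfolding exp_def by (rule sum_le_suminf[OF summable_exp_generic]) simp_all
  hence "32 / 10 \<le> exp (59 / 50 :: real)"
    by (simp add: eval_nat_numeral)
  hence "pi < exp (59 / 50)" using pi_approx(2) by simp
  hence "ln pi < ln (exp (59 / 50))" by (subst ln_less_cancel_iff) auto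
  thus "ln pi < 59 / 50" by simp
qed

section \<open>Derivatives of \<open>f\<close>, \<open>g\<close> and \<open>k\<close>, where
  \<open>r\<close> is the logarithmic derivative of \<open>k\<close>\<close>

context
  fixes f f' g g' k r :: "real \<Rightarrow> real"
  defines "f \<equiv> \<lambda>x. x * ln pi - ln_Gamma (x + 1)"
    and "f' \<equiv> \<lambda>x. ln pi - Digamma (x + 1)"
    and "g \<equiv> \<lambda>x. ln (x\<^sup>2 + 1) - ln (x + 1)"
    and "g' \<equiv> \<lambda>x. 2 * x / (x\<^sup>2 + 1) - 1 / (x + 1)"
    and "k \<equiv> \<lambda>x. (x\<^sup>2 + 1) * (x + 1) / (x\<^sup>2 + 2 * x - 1)"
    and "r \<equiv> \<lambda>x. 2 * x / (x\<^sup>2 + 1) + 1 / (x + 1) - (2 * x + 2) / (x\<^sup>2 + 2 * x - 1)"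
begin

private lemma k_denominator_pos: "x \<ge> 1 \<Longrightarrow> x\<^sup>2 + 2 * x - 1 > (0 :: real)"
  using zero_le_power2[of x] by linarith

private lemma square_plus_1_pos: "x\<^sup>2 + 1 > (0 :: real)"
  by (simp add: add_nonneg_pos)

private lemma k_pos: "x \<ge> 1 \<Longrightarrow> k x > 0"
  using k_denominator_pos[of x] square_plus_1_pos[of x] by (simp add: k_def)

private lemma k_g': "x \<ge> 1 \<Longrightarrow> k x * g' x = 1"
proof -
  assume x: "x \<ge> 1"
  have "g' x = (x\<^sup>2 + 2 * x - 1) / ((x\<^sup>2 + 1) * (x + 1))"
    using x square_plus_1_pos[of x] unfolding g'_def
    by (simp add: divide_simps) (simp add: algebra_simps power2_eq_square)
  thus ?thesis
    using x k_denominator_pos[OF x] square_plus_1_pos[of x] by (simp add: k_def)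
qed

private lemma f_deriv: "x \<ge> 1 \<Longrightarrow> (f has_real_derivative f' x) (at x)"
  unfolding f_def f'_def by (auto intro!: derivative_eq_intros)

private lemma f'_deriv:
  "x \<ge> 1 \<Longrightarrow> (f' has_real_derivative - Polygamma 1 (x + 1)) (at x)"
  unfolding f'_def by (auto intro!: derivative_eq_intros)

private lemma g_deriv: "x \<ge> 1 \<Longrightarrow> (g has_real_derivative g' x) (at x)"
  unfolding g_def g'_def using square_plus_1_pos[of x]
  by (auto intro!: derivative_eq_intros simp: divide_simps)

private lemma k_deriv: "x \<ge> 1 \<Longrightarrow> (k has_real_derivative k x * r x) (at x)"
proof -
  assume x: "x \<ge> 1"
  define a b c where "a = x\<^sup>2 + 1" and "b = x + 1" and "c = x\<^sup>2 + 2 * x - 1"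
  have nz: "a \<noteq> 0" "b \<noteq> 0" "c \<noteq> 0"
    using x k_denominator_pos[OF x] square_plus_1_pos[of x] by (auto simp: a_def b_def c_def)
  have eq: "((2 * x * b + a) * c - a * b * (2 * x + 2)) / (c * c) =
        a * b / c * (2 * x / a + 1 / b - (2 * x + 2) / c)"
    using nz by (simp add: divide_simps)
  have "(k has_real_derivative ((2 * x * b + a) * c - a * b * (2 * x + 2)) / (c * c)) (at x)"
    unfolding k_def a_def b_def c_def using nz
    by (auto intro!: derivative_eq_intros simp: c_def)
  thus ?thesis unfolding eq by (simp add: k_def r_def a_def b_def c_def)
qed

private lemma g_pos: "x > 1 \<Longrightarrow> g x > 0"
proof -
  assume "x > 1"
  hence "x + 1 < x\<^sup>2 + 1" by (simp add: power2_eq_square)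
  thus ?thesis using \<open>x > 1\<close> by (simp add: g_def)
qed

section \<open>Bounds for \<open>r\<close>\<close>

private lemma r_eq:
  assumes "x \<ge> 1"
  shows "r x = (x ^ 4 + 4 * x ^ 3 - 2 * x\<^sup>2 - 4 * x - 3) / ((x\<^sup>2 + 1) * (x + 1) * (x\<^sup>2 + 2 * x - 1))"
proof -
  define a b c where "a = x\<^sup>2 + 1" and "b = x + 1" and "c = x\<^sup>2 + 2 * x - 1"
  have nz: "a \<noteq> 0" "b \<noteq> 0" "c \<noteq> 0"
    using assms k_denominator_pos[OF assms] square_plus_1_pos[of x]
    by (auto simp: a_def b_def c_def)
  have "2 * x / a + 1 / b - (2 * x + 2) / c = (2 * x * b * c + a * c - (2 * x + 2) * a * b) / (a * b * c)"
    using nz by (simp add: divide_simps) (simp add: algebra_simps)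
  also have "2 * x * b * c + a * c - (2 * x + 2) * a * b = x ^ 4 + 4 * x ^ 3 - 2 * x\<^sup>2 - 4 * x - 3"
    unfolding a_def b_def c_def by algebra
  finally show ?thesis by (simp add: r_def a_def b_def c_def)
qed

private lemma r_less:
  assumes x: "x \<ge> 1"
  shows "r x < 8 / 25"
proof -
  \<comment> \<open>A certificate of positivity: \<open>x\<close> times a square that vanishes near
    x = 2.33, a second square, and a remainder with positive coefficients.\<close>
  have "8 * ((x\<^sup>2 + 1) * (x + 1) * (x\<^sup>2 + 2 * x - 1)) - 25 * (x ^ 4 + 4 * x ^ 3 - 2 * x\<^sup>2 - 4 * x - 3) =
      8 * x * (x\<^sup>2 - x / 16 - 263 / 50)\<^sup>2 + 60 * (x - 19 / 20)\<^sup>2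
      + 103 / 800 * x ^ 3 + 37 / 50 * x\<^sup>2 + 412 / 625 * x + 257 / 20"
    by algebra
  also have "\<dots> > 0" using x by (intro add_nonneg_pos add_nonneg_nonneg) auto
  finally have
    "25 * (x ^ 4 + 4 * x ^ 3 - 2 * x\<^sup>2 - 4 * x - 3) < 8 * ((x\<^sup>2 + 1) * (x + 1) * (x\<^sup>2 + 2 * x - 1))"
    by simp
  thus ?thesis
    unfolding r_eq[OF x] using x k_denominator_pos[OF x] square_plus_1_pos[of x]
    by (subst pos_divide_less_eq) auto
qed

private lemma r_pos:
  assumes x: "x \<ge> 2"
  shows "r x > 0"
proof -
  \<comment> \<open>Powers of \<open>x\<close> are split off against \<open>x - 2\<close>, so that
    no summand is negative for x \<ge> 2.\<close>
  have "x ^ 4 + 4 * x ^ 3 - 2 * x\<^sup>2 - 4 * x - 3 =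
      x ^ 4 + 4 * x\<^sup>2 * (x - 2) + 6 * (x * (x - 2)) + 8 * (x - 2) + 13"
    by algebra
  also have "\<dots> > 0" using x by (intro add_nonneg_pos add_nonneg_nonneg) auto
  finally show ?thesis
    unfolding r_eq[OF order.trans[OF one_le_numeral x]]
    using x k_denominator_pos[of x] square_plus_1_pos[of x] by simp
qed

section \<open>Monotonicity of \<open>f'\<close> and its values at 1, 2 and 3\<close>

private lemma f'_antimono:
  assumes "1 \<le> x" "x \<le> y"
  shows "f' y \<le> f' x"
proof (rule DERIV_nonpos_imp_nonincreasing[OF assms(2)])
  fix t assume "x \<le> t" "t \<le> y"
  hence t: "t \<ge> 1" using assms by linarith
  have "0 < 1 / (t + 1)" using t by simp
  also have "\<dots> \<le> Polygamma 1 (t + 1)" using t by (intro Polygamma_1_ge_inverse) simp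
  finally show "\<exists>d. (f' has_real_derivative d) (at t) \<and> d \<le> 0"
    using f'_deriv[OF t] by (intro exI[of _ "- Polygamma 1 (t + 1)"]) auto
qed

text \<open>At positive integers the digamma function is a harmonic number minus Euler's constant,
  so rational bounds for that constant and \<open>ln pi\<close> settle the values needed.\<close>

private lemma f'_nat: "f' (real n) = ln pi - harm n + euler_mascheroni"
  using Digamma_of_nat[of n, where 'a = real] by (simp add: f'_def add.commute)

private lemma f'_1: "f' 1 < 39 / 50"
  using f'_nat[of 1] ln_pi_bounds euler_mascheroni_less_13_over_22
  by (simp add: harm_expand)

private lemma f'_2: "f' 2 > 0"
  using f'_nat[of 2] ln_pi_bounds euler_mascheroni_gt_19_over_33
  by (simp add: harm_expand)

private lemma f'_3: "f' 3 < 0"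
  using f'_nat[of 3] ln_pi_bounds euler_mascheroni_less_13_over_22
  by (simp add: harm_expand)

section \<open>Monotonicity of \<open>f / g\<close>\<close>

private lemma f'_r_less:
  assumes x: "x \<ge> 1"
  shows "f' x * r x < Polygamma 1 (x + 1)"
proof (cases "x \<le> 3")
  case True
  have "f' x * r x < 1 / 4"
  proof (cases "f' x * r x \<le> 0")
    case False
    \<comment> \<open>Upper bounds may be multiplied only for nonnegative factors. As the product is
      positive, the sign of one factor decides: that of \<open>f'\<close> up to 2, that of
      \<open>r\<close> beyond.\<close>
    have "f' x > 0 \<and> r x > 0"
    proof (cases "x \<le> 2")
      case True
      hence "f' x > 0" using f'_antimono[of x 2] f'_2 x by simp
      thus ?thesis using False by (auto simp: zero_less_mult_iff not_le)
    next
      case 2: False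
      hence "r x > 0" using r_pos[of x] by simp
      thus ?thesis using False by (auto simp: zero_less_mult_iff not_le)
    qed
    \<comment> \<open>The product of the constants is 0.2496, just below 1/4, the minimum of 1 / (x
      + 1) on [1, 3].\<close>
    hence "f' x * r x \<le> (39 / 50) * (8 / 25)"
      using f'_antimono[of 1 x] f'_1 r_less[OF x] x by (intro mult_mono) auto
    thus ?thesis by simp
  qed simp
  also have "1 / 4 \<le> 1 / (x + 1)" using x True by (simp add: field_simps)
  also have "\<dots> \<le> Polygamma 1 (x + 1)" using x by (intro Polygamma_1_ge_inverse) simp
  finally show ?thesis .
next
  case False
  hence "f' x < 0" "r x > 0" using f'_antimono[of 3 x] f'_3 r_pos[of x] by auto
  hence "f' x * r x < 0" by (simp add: mult_neg_pos)
  also have "0 < 1 / (x + 1)" using x by simp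
  also have "\<dots> \<le> Polygamma 1 (x + 1)" using x by (intro Polygamma_1_ge_inverse) simp
  finally show ?thesis .
qed

private lemma f'_g_less:
  assumes x: "x > 1"
  shows "f' x * g x < f x * g' x"
proof -
  define h where "h = (\<lambda>t. f' t * k t * g t - f t)"
  have g_nonneg: "g t \<ge> 0" if "t \<ge> 1" for t
    using g_pos[of t] that by (cases "t = 1") (auto simp: g_def)
  have "h x \<le> h 1"
  proof (rule DERIV_nonpos_imp_nonincreasing[where f = h])
    fix t assume "1 \<le> t" "t \<le> x"
    note t = \<open>1 \<le> t\<close>
    define d where
      "d = ((- Polygamma 1 (t + 1)) * k t + (k t * r t) * f' t) * g t + g' t * (f' t * k t) - f' t"
    have "(h has_real_derivative d) (at t)"
      unfolding h_def d_def
      by (intro DERIV_diff DERIV_mult f_deriv f'_deriv g_deriv k_deriv t)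
    \<comment> \<open>The terms in \<open>f'\<close> alone cancel because
      \<open>k t * g' t = 1\<close>; the remaining bracket is negative by
      \<open>f'_r_less\<close>.\<close>
    moreover have "d = k t * g t * (f' t * r t - Polygamma 1 (t + 1)) + f' t * (k t * g' t - 1)"
      by (simp add: d_def algebra_simps)
    hence "d = k t * g t * (f' t * r t - Polygamma 1 (t + 1))"
      by (simp add: k_g'[OF t])
    hence "d \<le> 0"
      using k_pos[OF t] g_nonneg[OF t] f'_r_less[OF t] by (simp add: mult_nonneg_nonpos)
    ultimately show "\<exists>d. (h has_real_derivative d) (at t) \<and> d \<le> 0" by blast
  qed (use x in simp)
  \<comment> \<open>\<open>g 1 = 0\<close> removes the product, and Gamma(2) = 1 gives
    \<open>f 1 = ln pi\<close>.\<close>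
  also have "h 1 = - ln pi"
    using ln_Gamma_real_pos[of 2] Gamma_fact[of 1, where 'a = real] by (simp add: h_def g_def f_def)
  also have "\<dots> < 0" using ln_pi_bounds by linarith
  finally have h: "h x < 0" .
  have k: "k x * g' x = 1" and kpos: "k x > 0" using k_g'[of x] k_pos[of x] x by auto
  have g': "g' x > 0" using k kpos zero_less_mult_pos[of "k x" "g' x"] by simp
  \<comment> \<open>Inserting the factor \<open>k x * g' x = 1\<close> exposes \<open>h x\<close> in
    the numerator of the derivative of \<open>f / g\<close>.\<close>
  have "f' x * g x - f x * g' x = f' x * g x * (k x * g' x) - f x * g' x" by (simp add: k)
  also have "\<dots> = g' x * h x" by (simp add: h_def algebra_simps)
  also have "\<dots> < 0" using g' h by (rule mult_pos_neg)
  finally show ?thesis by simp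
qed

lemma exponent_quotient_decreasing:
  assumes "1 < x" "x < y"
  shows "f y / g y < f x / g x"
proof (rule DERIV_neg_imp_decreasing[OF assms(2)])
  fix t assume "x \<le> t" "t \<le> y"
  hence t: "t > 1" using assms by simp
  have "((\<lambda>t. f t / g t) has_real_derivative (f' t * g t - f t * g' t) / (g t * g t)) (at t)"
    using t g_pos[OF t] by (intro DERIV_divide f_deriv g_deriv) auto
  moreover have "(f' t * g t - f t * g' t) / (g t * g t) < 0"
    using f'_g_less[OF t] g_pos[OF t] by (intro divide_neg_pos) auto
  ultimately show "\<exists>d. ((\<lambda>t. f t / g t) has_real_derivative d) (at t) \<and> d < 0" by blast
qed

end

section \<open>From the exponent to the powers and the ball volumes\<close>

lemma powr_quotient_decreasing:
  fixes x y :: real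
  assumes "1 < x" "x < y"
  shows "(pi powr y / Gamma (y + 1)) powr (1 / (ln (y\<^sup>2 + 1) - ln (y + 1)))
       < (pi powr x / Gamma (x + 1)) powr (1 / (ln (x\<^sup>2 + 1) - ln (x + 1)))"
proof -
  \<comment> \<open>The base is itself an exponential, so the power is \<open>exp\<close> of the
    quotient already treated, and \<open>exp\<close> is strictly increasing.\<close>
  have eq: "(pi powr t / Gamma (t + 1)) powr (1 / c) = exp ((t * ln pi - ln_Gamma (t + 1)) / c)"
    if "t > 1" for t c :: real
  proof -
    have "pi powr t / Gamma (t + 1) = exp (t * ln pi - ln_Gamma (t + 1))"
      using that by (simp add: powr_def Gamma_real_pos_exp exp_diff)
    thus ?thesis by (simp add: powr_def)
  qed
  show ?thesis
    using assms exponent_quotient_decreasing[OF assms] by (simp add: eq)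
qed

theorem theorem2:
  shows "strict_antimono_on {1<..}
           (\<lambda>x::real. (pi powr x / Gamma (x + 1)) powr (1 / (ln (x\<^sup>2 + 1) - ln (x + 1))))
       \<and> strict_antimono_on {3..}
           (\<lambda>n::nat. unit_ball_vol (real n) powr
              (1 / (ln ((real n)\<^sup>2 / 4 + 1) - ln (real n / 2 + 1))))"
proof
  show "strict_antimono_on {1<..}
           (\<lambda>x::real. (pi powr x / Gamma (x + 1)) powr (1 / (ln (x\<^sup>2 + 1) - ln (x + 1))))"
    by (intro monotone_onI) (auto intro!: powr_quotient_decreasing)
  show "strict_antimono_on {3..}
           (\<lambda>n::nat. unit_ball_vol (real n) powr
              (1 / (ln ((real n)\<^sup>2 / 4 + 1) - ln (real n / 2 + 1))))"
  proof (rule monotone_onI)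
    fix m n :: nat assume "m \<in> {3..}" "n \<in> {3..}" "m < n"
    \<comment> \<open>The sequence is the function sampled at x = n / 2, and n \<ge> 3 places these
      points in the interval (1, \<infinity>).\<close>
    hence "1 < real m / 2" "real m / 2 < real n / 2" by auto
    from powr_quotient_decreasing[OF this]
    show "unit_ball_vol (real n) powr (1 / (ln ((real n)\<^sup>2 / 4 + 1) - ln (real n / 2 + 1)))
        < unit_ball_vol (real m) powr (1 / (ln ((real m)\<^sup>2 / 4 + 1) - ln (real m / 2 + 1)))"
      by (simp add: unit_ball_vol_def power_divide)
  qed
qed

end
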